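(* Let $X,Y$ be Banach spaces, $T:X\to Y$ a bounded linear operator and $1\le p<2$. If $T$ is of weak Haar type $p$, then there exists a constant $c\ge0$ such that $\tau_p(T|\mathcal H(\mathbb D_1^n))\le c\,(1+\log n)$ for all $n\in\mathbb N$.
   Context: Dyadic intervals: $\Delta_k^{(j)}:=[\frac{j-1}{2^k},\frac{j}{2^k})$. Haar functions: for $k\ge1$, integer $j$, $\chi_k^{(j)}(t)=+2^{(k-1)/2}$ on $\Delta_k^{(2j-1)}$, $-2^{(k-1)/2}$ on $\Delta_k^{(2j)}$, $0$ otherwise, $t\in[0,1)$. $\mathbb D_1^n:=\{(k,j):k=1,\dots,n;\ j=1,\dots,2^{k-1}\}$. $\|f|L_q\|$ is the Bochner $L_q([0,1))$-norm of a vector-valued function. $\tau(T|\mathcal H(\mathbb D_1^n))$ is the least $c\ge0$ with $\|\sum_{(k,j)\in\mathbb D_1^n}Tx_k^{(j)}\chi_k^{(j)}|L_2\|\le c(\sum_{(k,j)\in\mathbb D_1^n}\|x_k^{(j)}\|^2)^{1/2}$ for all $x_k^{(j)}\in X$. For $1\le q\le2$, $\tau_q(T|\mathcal H(\mathbb D_1^n))$ is the least $c\ge0$ with $\|\sum_{(k,j)\in\mathbb D_1^n}Tx_k^{(j)}\chi_k^{(j)}|L_q\|\le c(\sum_{k=1}^n\|\sum_{j=1}^{2^{k-1}}x_k^{(j)}\chi_k^{(j)}|L_q\|^q)^{1/q}$ for all $x_k^{(j)}\in X$. For $1\le p<2$, $T$ is of weak Haar type $p$ if there is $c\ge0$ with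 $\tau(T|\mathcal H(\mathbb D_1^n))\le c\,n^{1/p-1/2}$ for all $n\in\mathbb N$. *)

theory Defs
  imports "HOL-Analysis.Analysis"
begin

definition haar :: "nat \<Rightarrow> nat \<Rightarrow> real \<Rightarrow> real" where
  "haar k j t =
     (if t < 0 \<or> 1 \<le> t then 0
      else if (2 * real j - 2) / 2 ^ k \<le> t \<and> t < (2 * real j - 1) / 2 ^ k
        then 2 powr ((real k - 1) / 2)
      else if (2 * real j - 1) / 2 ^ k \<le> t \<and> t < (2 * real j) / 2 ^ k
        then - (2 powr ((real k - 1) / 2))
      else 0)"

definition dyadic_index :: "nat \<Rightarrow> (nat \<times> nat) set" where
  "dyadic_index n = {(k, j). 1 \<le> k \<and> k \<le> n \<and> 1 \<le> j \<and> j \<le> 2 ^ (k - 1)}"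

definition Lq_norm :: "real \<Rightarrow> (real \<Rightarrow> 'a::real_normed_vector) \<Rightarrow> real" where
  "Lq_norm q f = (LINT t:{0..<1}|lborel. norm (f t) powr q) powr (1 / q)"

definition haar_tau :: "('a::real_normed_vector \<Rightarrow> 'b::real_normed_vector) \<Rightarrow> nat \<Rightarrow> real" where
  "haar_tau T n = Inf {c. 0 \<le> c \<and>
     (\<forall>x :: nat \<Rightarrow> nat \<Rightarrow> 'a.
        Lq_norm 2 (\<lambda>t. \<Sum>(k, j)\<in>dyadic_index n. haar k j t *\<^sub>R T (x k j))
        \<le> c * sqrt (\<Sum>(k, j)\<in>dyadic_index n. (norm (x k j))\<^sup>2))}"

definition haar_tau_q :: "real \<Rightarrow> ('a::real_normed_vector \<Rightarrow> 'b::real_normed_vector) \<Rightarrow> nat \<Rightarrow> real" where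
  "haar_tau_q q T n = Inf {c. 0 \<le> c \<and>
     (\<forall>x :: nat \<Rightarrow> nat \<Rightarrow> 'a.
        Lq_norm q (\<lambda>t. \<Sum>(k, j)\<in>dyadic_index n. haar k j t *\<^sub>R T (x k j))
        \<le> c * (\<Sum>k = 1..n. (Lq_norm q (\<lambda>t. \<Sum>j = 1..2 ^ (k - 1). haar k j t *\<^sub>R x k j)) powr q)
              powr (1 / q))}"

definition weak_haar_type :: "real \<Rightarrow> ('a::real_normed_vector \<Rightarrow> 'b::real_normed_vector) \<Rightarrow> bool" where
  "weak_haar_type p T \<longleftrightarrow>
     (\<exists>c\<ge>0. \<forall>n\<ge>1. haar_tau T n \<le> c * real n powr (1 / p - 1 / 2))"

end

theory Submission
  imports Defs "HOL-Library.Tree"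
begin

text \<open>The values of a Haar martingale difference sequence \<open>d\<close> along the points of \<open>[0,1)\<close> are the signed
  branches of a binary tree, and integrals become averages over branches. The weak type inequality
  with \<open>N\<close> levels extends to deeper trees with at most \<open>N\<close> nonzero nodes on each branch. If
  \<open>\<Sum> \<parallel>d\<^sub>k\<parallel>\<^sup>p \<le> r\<^sup>p\<close> pointwise, splitting the nodes by size into about \<open>log n\<close> dyadic levels gives
  \<open>\<parallel>\<Sum> T d\<^sub>k | L\<^sub>2\<parallel> \<le> A r\<close> with \<open>A\<close> of order \<open>1 + log n\<close>. Since \<open>\<parallel>d\<^sub>k\<parallel>\<close> is predictable, stopping turns this into
  a good-lambda inequality between the maximal function of \<open>\<Sum> T d\<^sub>k\<close> and \<open>(\<Sum> \<parallel>d\<^sub>k\<parallel>\<^sup>p)\<^sup>1\<^sup>/\<^sup>p\<close>, and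
  integrating over the threshold yields the strong type \<open>p\<close> estimate with a constant multiple of \<open>A\<close>.\<close>

section \<open>Expectations over the signed branches of a binary tree\<close>

text \<open>A node value is a martingale difference on the left half of a dyadic interval, its
  negative the one on the right half. Both halves share the norm, which is the predictability that
  stopping exploits. Subtrees may differ in depth, so stopped trees stay in the same type.\<close>

primrec branches :: "'a::real_vector tree \<Rightarrow> 'a list set" where
  "branches Leaf = {[]}"
| "branches (Node l a r) = (#) a ` branches l \<union> (#) (- a) ` branches r"

text \<open>Recursion is used and not an average over the set \<open>branches t\<close>: different
  paths can carry equal lists, for instance through a zero node, and must be counted with
  multiplicity. A path of length \<open>m\<close> has weight \<open>1 / 2 ^ m\<close>.\<close>

primrec branch_mean :: "'a::real_vector tree \<Rightarrow> ('a list \<Rightarrow> real) \<Rightarrow> real" where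
  "branch_mean Leaf F = F []"
| "branch_mean (Node l a r) F =
     (branch_mean l (\<lambda>w. F (a # w)) + branch_mean r (\<lambda>w. F (- a # w))) / 2"

lemma branches_nonempty: "branches t \<noteq> {}"
  by (induction t) auto

lemma branch_mean_mono:
  assumes "\<And>w. w \<in> branches t \<Longrightarrow> F w \<le> G w"
  shows "branch_mean t F \<le> branch_mean t G"
  using assms
proof (induction t arbitrary: F G)
  case (Node l a r)
  have "branch_mean l (\<lambda>w. F (a # w)) \<le> branch_mean l (\<lambda>w. G (a # w))"
    by (rule Node.IH(1)) (auto intro: Node.prems)
  moreover have "branch_mean r (\<lambda>w. F (- a # w)) \<le> branch_mean r (\<lambda>w. G (- a # w))"
    by (rule Node.IH(2)) (auto intro: Node.prems)
  ultimately show ?case by simp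
qed simp

lemma branch_mean_cong:
  assumes "\<And>w. w \<in> branches t \<Longrightarrow> F w = G w"
  shows "branch_mean t F = branch_mean t G"
  by (rule antisym; rule branch_mean_mono) (simp_all add: assms)

lemma branch_mean_const [simp]: "branch_mean t (\<lambda>_. c) = c"
  by (induction t) auto

lemma branch_mean_add:
  "branch_mean t (\<lambda>w. F w + G w) = branch_mean t F + branch_mean t G"
  by (induction t arbitrary: F G) (auto simp: field_simps)

lemma branch_mean_cmult: "branch_mean t (\<lambda>w. c * F w) = c * branch_mean t F"
  by (induction t arbitrary: F) (auto simp: field_simps)

lemma branch_mean_diff:
  "branch_mean t (\<lambda>w. F w - G w) = branch_mean t F - branch_mean t G"
  using branch_mean_add[of t F "\<lambda>w. (- 1) * G w"] branch_mean_cmult[of t "- 1" G] by simp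

lemma branch_mean_sum:
  "branch_mean t (\<lambda>w. \<Sum>i\<in>I. F i w) = (\<Sum>i\<in>I. branch_mean t (F i))"
  by (induction I rule: infinite_finite_induct) (simp_all add: branch_mean_add)

lemma branch_mean_nonneg:
  "(\<And>w. w \<in> branches t \<Longrightarrow> 0 \<le> F w) \<Longrightarrow> 0 \<le> branch_mean t F"
  using branch_mean_mono[of t "\<lambda>_. 0" F] by simp

text \<open>Oddness lets \<open>g\<close> commute with the sign change on right halves, so
  restricting node values to one size range again gives martingale differences.\<close>

lemma branch_mean_map_tree:
  assumes "\<And>a. g (- a) = - g a"
  shows "branch_mean (map_tree g t) F = branch_mean t (\<lambda>w. F (map g w))"
  by (induction t arbitrary: F) (auto simp: assms)

lemma branches_map_tree:
  assumes "\<And>a. g (- a) = - g a"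
  shows "branches (map_tree g t) = map g ` branches t"
  by (induction t) (auto simp: assms image_Un image_image)

text \<open>A tree has only finitely many branches, so no uniformity in \<open>w\<close> is
  required. This later removes the cutoff of the maximal function.\<close>

lemma eventually_branch_mean_eq:
  assumes "\<And>w. eventually (\<lambda>R. F R w = G w) net"
  shows "eventually (\<lambda>R. branch_mean t (F R) = branch_mean t G) net"
  using assms
proof (induction t arbitrary: F G)
  case (Node l a r)
  have "eventually (\<lambda>R. branch_mean l (\<lambda>w. F R (a # w)) = branch_mean l (\<lambda>w. G (a # w))) net"
    by (rule Node.IH(1)) (rule Node.prems)
  moreover have "eventually (\<lambda>R. branch_mean r (\<lambda>w. F R (- a # w)) = branch_mean r (\<lambda>w. G (- a # w))) net"
    by (rule Node.IH(2)) (rule Node.prems)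
  ultimately show ?case by eventually_elim simp
qed simp

lemma has_integral_branch_mean:
  fixes F :: "real \<Rightarrow> 'a::real_vector list \<Rightarrow> real"
  assumes "\<And>w. ((\<lambda>s. F s w) has_integral G w) S"
  shows "((\<lambda>s. branch_mean t (F s)) has_integral branch_mean t G) S"
  using assms
proof (induction t arbitrary: F G)
  case (Node l a r)
  have "((\<lambda>s. branch_mean l (\<lambda>w. F s (a # w))) has_integral branch_mean l (\<lambda>w. G (a # w))) S"
    by (rule Node.IH(1)) (rule Node.prems)
  moreover have "((\<lambda>s. branch_mean r (\<lambda>w. F s (- a # w))) has_integral branch_mean r (\<lambda>w. G (- a # w))) S"
    by (rule Node.IH(2)) (rule Node.prems)
  ultimately have "((\<lambda>s. branch_mean l (\<lambda>w. F s (a # w)) + branch_mean r (\<lambda>w. F s (- a # w)))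
      has_integral (branch_mean l (\<lambda>w. G (a # w)) + branch_mean r (\<lambda>w. G (- a # w)))) S"
    by (rule has_integral_add)
  from has_integral_divide[OF this, of 2] show ?case by simp
qed simp


section \<open>Haar sums as trees\<close>

text \<open>The factors \<open>sqrt 2\<close> account for the \<open>L\<^sub>2\<close>-normalisation of the Haar functions: the
  entries of a branch are the values of the martingale differences themselves.\<close>

primrec haar_tree :: "nat \<Rightarrow> (nat \<Rightarrow> nat \<Rightarrow> 'a::real_vector) \<Rightarrow> 'a tree" where
  "haar_tree 0 x = Leaf"
| "haar_tree (Suc n) x =
     Node (haar_tree n (\<lambda>k j. sqrt 2 *\<^sub>R x (Suc k) j)) (x 1 1)
          (haar_tree n (\<lambda>k j. sqrt 2 *\<^sub>R x (Suc k) (j + 2 ^ (k - 1))))"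

definition haar_diff :: "(nat \<Rightarrow> nat \<Rightarrow> 'a::real_vector) \<Rightarrow> real \<Rightarrow> nat \<Rightarrow> 'a" where
  "haar_diff x t k = (\<Sum>j = 1..2 ^ (k - 1). haar k j t *\<^sub>R x k j)"

definition haar_diffs :: "nat \<Rightarrow> (nat \<Rightarrow> nat \<Rightarrow> 'a::real_vector) \<Rightarrow> real \<Rightarrow> 'a list" where
  "haar_diffs n x t = map (haar_diff x t) [1..<Suc n]"

lemma length_branches_haar_tree: "w \<in> branches (haar_tree n x) \<Longrightarrow> length w = n"
  by (induction n arbitrary: x w) auto

lemma haar_tree_cong:
  assumes "\<And>k j. 1 \<le> k \<Longrightarrow> k \<le> n \<Longrightarrow> 1 \<le> j \<Longrightarrow> j \<le> 2 ^ (k - 1) \<Longrightarrow> x k j = y k j"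
  shows "haar_tree n x = haar_tree n y"
  using assms
proof (induction n arbitrary: x y)
  case (Suc n)
  have pow: "(2::nat) ^ k = 2 ^ (k - 1) + 2 ^ (k - 1)" if "1 \<le> k" for k
    using that by (cases k) auto
  have "haar_tree n (\<lambda>k j. sqrt 2 *\<^sub>R x (Suc k) j) = haar_tree n (\<lambda>k j. sqrt 2 *\<^sub>R y (Suc k) j)"
    by (rule Suc.IH) (use Suc.prems pow in force)
  moreover have "haar_tree n (\<lambda>k j. sqrt 2 *\<^sub>R x (Suc k) (j + 2 ^ (k - 1))) =
      haar_tree n (\<lambda>k j. sqrt 2 *\<^sub>R y (Suc k) (j + 2 ^ (k - 1)))"
    by (rule Suc.IH) (use Suc.prems pow in force)
  moreover have "x 1 1 = y 1 1" by (rule Suc.prems) auto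
  ultimately show ?case by simp
qed simp

text \<open>Gluing two Haar trees under a root is what rebuilding a compressed tree requires. Level
  \<open>k\<close> of the glued family holds level \<open>k - 1\<close> of both families, the first
  \<open>2 ^ (k - 2)\<close> indices belonging to the left one; \<open>1 / sqrt 2\<close> undoes the
  scaling in \<open>haar_tree\<close>.\<close>

lemma ex_haar_tree_Node: "\<exists>x. haar_tree (Suc n) x = Node (haar_tree n u) a (haar_tree n v)"
proof -
  define x where "x k j = (if k = 1 then a else if j \<le> 2 ^ (k - 2) then (1 / sqrt 2) *\<^sub>R u (k - 1) j
      else (1 / sqrt 2) *\<^sub>R v (k - 1) (j - 2 ^ (k - 2)))" for k j :: nat
  have "haar_tree n (\<lambda>k j. sqrt 2 *\<^sub>R x (Suc k) j) = haar_tree n u"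
    by (rule haar_tree_cong) (auto simp: x_def numeral_2_eq_2)
  moreover have "haar_tree n (\<lambda>k j. sqrt 2 *\<^sub>R x (Suc k) (j + 2 ^ (k - 1))) = haar_tree n v"
    by (rule haar_tree_cong) (auto simp: x_def numeral_2_eq_2)
  ultimately have "haar_tree (Suc n) x = Node (haar_tree n u) a (haar_tree n v)"
    by (simp add: x_def)
  then show ?thesis by blast
qed

section \<open>Self-similarity of the Haar functions on the two halves of the unit interval\<close>

lemma sum_dyadic_split:
  fixes g :: "nat \<Rightarrow> 'a::comm_monoid_add"
  assumes "1 \<le> k"
  shows "(\<Sum>j = 1..2 ^ k. g j) = (\<Sum>j = 1..2 ^ (k - 1). g j) + (\<Sum>j = 1..2 ^ (k - 1). g (j + 2 ^ (k - 1)))"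
proof -
  have pow: "(2::nat) ^ k = 2 ^ (k - 1) + 2 ^ (k - 1)"
    using assms by (cases k) auto
  have "(\<Sum>j = 1..2 ^ k. g j) = (\<Sum>j = 1..2 ^ (k - 1). g j) + (\<Sum>j = 2 ^ (k - 1) + 1..2 ^ (k - 1) + 2 ^ (k - 1). g j)"
    unfolding pow by (rule sum.ub_add_nat) simp
  also have "(\<Sum>j = 2 ^ (k - 1) + 1..2 ^ (k - 1) + 2 ^ (k - 1). g j) = (\<Sum>j = 1..2 ^ (k - 1). g (j + 2 ^ (k - 1)))"
    using sum.shift_bounds_cl_nat_ivl[of g 1 "2 ^ (k - 1)" "2 ^ (k - 1)"] by (simp add: add.commute)
  finally show ?thesis .
qed

lemma powr_half_step: "1 \<le> k \<Longrightarrow> 2 powr ((real (Suc k) - 1) / 2) = sqrt 2 * 2 powr ((real k - 1) / 2)"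
  by (simp add: powr_half_sqrt[symmetric] powr_add[symmetric] field_simps)

lemma haar_left:
  assumes "1 \<le> k" "0 \<le> t" "t < 1"
  shows "haar (Suc k) j (t / 2) = sqrt 2 * haar k j t"
  using assms powr_half_step[OF assms(1)] by (auto simp: haar_def field_simps)

lemma haar_right:
  assumes "1 \<le> k" "0 \<le> t" "t < 1"
  shows "haar (Suc k) (j + 2 ^ (k - 1)) ((t + 1) / 2) = sqrt 2 * haar k j t"
proof -
  have pow: "(2::real) ^ k = 2 * 2 ^ (k - 1)"
    using assms by (cases k) auto
  show ?thesis
    using assms powr_half_step[OF assms(1)] by (auto simp: haar_def field_simps pow)
qed

text \<open>The dyadic interval of such an index starts at \<open>1\<close> or later. On the left
  half this discards the upper half of the indices of the next level; \<open>haar_right_zero\<close>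
  discards the lower half on the right.\<close>

lemma haar_eq_0:
  assumes "1 \<le> k" "t < 1" "1 \<le> j"
  shows "haar k (j + 2 ^ (k - 1)) t = 0"
proof -
  have pow: "(2::real) ^ k = 2 * 2 ^ (k - 1)"
    using assms by (cases k) auto
  have "1 \<le> (2 * real (j + 2 ^ (k - 1)) - 2) / 2 ^ k"
    using assms by (simp add: pow)
  moreover have "1 \<le> (2 * real (j + 2 ^ (k - 1)) - 1) / 2 ^ k"
    using assms by (simp add: pow)
  ultimately have "t < (2 * real (j + 2 ^ (k - 1)) - 2) / 2 ^ k" "t < (2 * real (j + 2 ^ (k - 1)) - 1) / 2 ^ k"
    using assms(2) by linarith+
  then show ?thesis
    unfolding haar_def by auto
qed

lemma haar_right_zero:
  assumes "1 \<le> k" "0 \<le> t" "j \<le> 2 ^ (k - 1)"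
  shows "haar (Suc k) j ((t + 1) / 2) = 0"
proof -
  have pow: "(2::real) ^ Suc k = 4 * 2 ^ (k - 1)"
    using assms by (cases k) auto
  have "real j \<le> 2 ^ (k - 1)"
    using assms(3) by (metis of_nat_le_iff of_nat_numeral of_nat_power)
  then have "2 * real j \<le> 2 ^ Suc k / 2" "2 * real j - 1 \<le> 2 ^ Suc k / 2"
    unfolding pow by linarith+
  then have "2 * real j / 2 ^ Suc k \<le> 1 / 2" "(2 * real j - 1) / 2 ^ Suc k \<le> 1 / 2"
    by (simp_all add: field_simps)
  moreover have "1 / 2 \<le> (t + 1) / 2" using assms by simp
  ultimately have "2 * real j / 2 ^ Suc k \<le> (t + 1) / 2" "(2 * real j - 1) / 2 ^ Suc k \<le> (t + 1) / 2"
    by (blast intro: order_trans)+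
  then show ?thesis
    unfolding haar_def by auto
qed

lemma haar_diff_left:
  assumes "1 \<le> k" "0 \<le> t" "t < 1"
  shows "haar_diff x (t / 2) (Suc k) = haar_diff (\<lambda>k j. sqrt 2 *\<^sub>R x (Suc k) j) t k"
  unfolding haar_diff_def diff_Suc_1 sum_dyadic_split[OF assms(1)]
  using assms by (simp add: haar_left haar_eq_0 mult.commute
      del: One_nat_def cong: sum.cong_simp)

lemma haar_diff_right:
  assumes "1 \<le> k" "0 \<le> t" "t < 1"
  shows "haar_diff x ((t + 1) / 2) (Suc k) =
    haar_diff (\<lambda>k j. sqrt 2 *\<^sub>R x (Suc k) (j + 2 ^ (k - 1))) t k"
  unfolding haar_diff_def diff_Suc_1 sum_dyadic_split[OF assms(1)]
  using assms by (simp add: haar_right haar_right_zero mult.commute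
      del: One_nat_def cong: sum.cong_simp)

lemma haar_diffs_Suc: "haar_diffs (Suc n) x t = haar_diff x t 1 # map (\<lambda>k. haar_diff x t (Suc k)) [1..<Suc n]"
proof -
  have "[1..<Suc (Suc n)] = 1 # map Suc [1..<Suc n]"
    by (subst upt_conv_Cons) (simp_all add: map_Suc_upt del: upt_Suc)
  then show ?thesis by (simp add: haar_diffs_def o_def del: upt_Suc)
qed

lemma haar_diffs_left:
  assumes "0 \<le> t" "t < 1"
  shows "haar_diffs (Suc n) x (t / 2) = x 1 1 # haar_diffs n (\<lambda>k j. sqrt 2 *\<^sub>R x (Suc k) j) t"
proof -
  have "haar_diff x (t / 2) 1 = x 1 1"
    using assms by (simp add: haar_diff_def haar_def)
  then show ?thesis
    unfolding haar_diffs_Suc unfolding haar_diffs_def using assms by (auto simp: haar_diff_left)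
qed

lemma haar_diffs_right:
  assumes "0 \<le> t" "t < 1"
  shows "haar_diffs (Suc n) x ((t + 1) / 2) =
    - x 1 1 # haar_diffs n (\<lambda>k j. sqrt 2 *\<^sub>R x (Suc k) (j + 2 ^ (k - 1))) t"
proof -
  have "haar_diff x ((t + 1) / 2) 1 = - x 1 1"
    using assms by (simp add: haar_diff_def haar_def)
  then show ?thesis
    unfolding haar_diffs_Suc unfolding haar_diffs_def using assms by (auto simp: haar_diff_right)
qed

text \<open>Halving \<open>[0,1)\<close> mirrors the recursion of the tree: the substitutions
  \<open>t / 2\<close> and \<open>(t + 1) / 2\<close> each contribute the factor \<open>1/2\<close>
  of the mean at a node. \<open>F\<close> can be arbitrary because the integrand is a step function;
  integrability comes out of the induction.\<close>

lemma has_bochner_integral_haar_diffs: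
  "has_bochner_integral lborel (\<lambda>t. indicator {0..<1} t * F (haar_diffs n x t)) (branch_mean (haar_tree n x) F)"
proof (induction n arbitrary: x F)
  case 0
  have "has_bochner_integral lborel (indicator {0..<1::real} :: real \<Rightarrow> real) (measure lborel {0..<1::real})"
    by (rule has_bochner_integral_real_indicator) auto
  from has_bochner_integral_mult_left[OF this, of "F []"]
  show ?case by (simp add: haar_diffs_def)
next
  case (Suc n)
  let ?u = "\<lambda>k j. sqrt 2 *\<^sub>R x (Suc k) j" and ?v = "\<lambda>k j. sqrt 2 *\<^sub>R x (Suc k) (j + 2 ^ (k - 1))"
  let ?D = "\<lambda>t. F (haar_diffs (Suc n) x t)"
  let ?l = "branch_mean (haar_tree n ?u) (\<lambda>w. F (x 1 1 # w))"
  let ?r = "branch_mean (haar_tree n ?v) (\<lambda>w. F (- x 1 1 # w))"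
  have "(\<lambda>t. indicator {0..<1/2} (0 + 1/2 * t) * ?D (0 + 1/2 * t))
      = (\<lambda>t. indicator {0..<1} t * F (x 1 1 # haar_diffs n ?u t))"
    using haar_diffs_left[of _ n x] by (auto simp: indicator_def fun_eq_iff)
  with Suc[where F = "\<lambda>w. F (x 1 1 # w)" and x = ?u]
  have "has_bochner_integral lborel (\<lambda>t. indicator {0..<1/2} t * ?D t) (?l / 2)"
    by (subst lborel_has_bochner_integral_real_affine_iff[where c = "1/2" and t = 0]) simp_all
  moreover have "(\<lambda>t. indicator {1/2..<1} (1/2 + 1/2 * t) * ?D (1/2 + 1/2 * t))
      = (\<lambda>t. indicator {0..<1} t * F (- x 1 1 # haar_diffs n ?v t))"
    using haar_diffs_right[of _ n x] by (auto simp: indicator_def fun_eq_iff add_divide_distrib add.commute)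
  with Suc[where F = "\<lambda>w. F (- x 1 1 # w)" and x = ?v]
  have "has_bochner_integral lborel (\<lambda>t. indicator {1/2..<1} t * ?D t) (?r / 2)"
    by (subst lborel_has_bochner_integral_real_affine_iff[where c = "1/2" and t = "1/2"]) simp_all
  ultimately have "has_bochner_integral lborel
      (\<lambda>t. indicator {0..<1/2} t * ?D t + indicator {1/2..<1} t * ?D t) (?l / 2 + ?r / 2)"
    by (rule has_bochner_integral_add)
  moreover have "(\<lambda>t. indicator {0..<1/2} t * ?D t + indicator {1/2..<1} t * ?D t)
      = (\<lambda>t. indicator {0..<1} t * ?D t)"
    by (auto simp: indicator_def fun_eq_iff)
  ultimately show ?case by (simp add: add_divide_distrib)
qed

lemma integral_haar_diffs:
  "(LINT t:{0..<1}|lborel. F (haar_diffs n x t)) = branch_mean (haar_tree n x) F"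
  using has_bochner_integral_integral_eq[OF has_bochner_integral_haar_diffs[of F n x]]
  by (simp add: set_lebesgue_integral_def)

section \<open>Norms of Haar sums as branch means\<close>

lemma dyadic_index_Sigma: "dyadic_index n = Sigma {1..n} (\<lambda>k. {1..2 ^ (k - 1)})"
  by (auto simp: dyadic_index_def)

lemma sum_list_haar_diffs: "sum_list (haar_diffs n x t) = (\<Sum>k = 1..n. haar_diff x t k)"
  unfolding haar_diffs_def
  by (subst sum_list_distinct_conv_sum_set)
    (simp_all add: atLeastLessThanSuc_atLeastAtMost del: upt_Suc)

lemma Lq_norm_haar_image:
  assumes "linear T"
  shows "Lq_norm q (\<lambda>t. \<Sum>(k, j)\<in>dyadic_index n. haar k j t *\<^sub>R T (x k j)) =
    (branch_mean (haar_tree n x) (\<lambda>w. norm (T (sum_list w)) powr q)) powr (1 / q)"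
proof -
  have "(\<Sum>(k, j)\<in>dyadic_index n. haar k j t *\<^sub>R T (x k j)) = T (sum_list (haar_diffs n x t))" for t
    unfolding dyadic_index_Sigma sum_list_haar_diffs haar_diff_def
    by (subst sum.Sigma[symmetric]) (simp_all add: linear_sum[OF assms] linear_scale[OF assms])
  then show ?thesis
    using integral_haar_diffs[of "\<lambda>w. norm (T (sum_list w)) powr q" n x] by (simp add: Lq_norm_def)
qed

text \<open>The outer power \<open>q\<close> cancels the root in \<open>Lq_norm\<close>, so the sum
  over levels passes under the mean and becomes a sum along each branch.\<close>

lemma sum_Lq_norm_haar_diff:
  assumes "0 < q"
  shows "(\<Sum>k = 1..n. (Lq_norm q (\<lambda>t. \<Sum>j = 1..2 ^ (k - 1). haar k j t *\<^sub>R x k j)) powr q) =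
    branch_mean (haar_tree n x) (\<lambda>w. \<Sum>a\<leftarrow>w. norm a powr q)"
proof -
  have "(Lq_norm q (\<lambda>t. \<Sum>j = 1..2 ^ (k - 1). haar k j t *\<^sub>R x k j)) powr q =
      branch_mean (haar_tree n x) (\<lambda>w. norm (w ! (k - 1)) powr q)" if k: "k \<in> {1..n}" for k
  proof -
    have "haar_diffs n x t ! (k - 1) = (\<Sum>j = 1..2 ^ (k - 1). haar k j t *\<^sub>R x k j)" for t
      using k by (cases k) (simp_all add: haar_diffs_def haar_diff_def nth_map_upt del: upt_Suc)
    then have "(LINT t:{0..<1}|lborel. norm (\<Sum>j = 1..2 ^ (k - 1). haar k j t *\<^sub>R x k j) powr q)
        = branch_mean (haar_tree n x) (\<lambda>w. norm (w ! (k - 1)) powr q)"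
      using integral_haar_diffs[of "\<lambda>w. norm (w ! (k - 1)) powr q" n x] by simp
    moreover have "0 \<le> branch_mean (haar_tree n x) (\<lambda>w. norm (w ! (k - 1)) powr q)"
      by (rule branch_mean_nonneg) simp
    ultimately show ?thesis
      using assms by (simp add: Lq_norm_def powr_powr)
  qed
  then have "(\<Sum>k = 1..n. (Lq_norm q (\<lambda>t. \<Sum>j = 1..2 ^ (k - 1). haar k j t *\<^sub>R x k j)) powr q) =
      branch_mean (haar_tree n x) (\<lambda>w. \<Sum>k = 1..n. norm (w ! (k - 1)) powr q)"
    by (simp add: branch_mean_sum)
  also have "\<dots> = branch_mean (haar_tree n x) (\<lambda>w. \<Sum>a\<leftarrow>w. norm a powr q)"
  proof (rule branch_mean_cong)
    fix w assume "w \<in> branches (haar_tree n x)"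
    then have "length w = n" by (rule length_branches_haar_tree)
    then show "(\<Sum>k = 1..n. norm (w ! (k - 1)) powr q) = (\<Sum>a\<leftarrow>w. norm a powr q)"
      by (simp add: sum_list_sum_nth sum.atLeast1_atMost_eq atLeast0LessThan)
  qed
  finally show ?thesis .
qed

text \<open>The normalisation of the Haar functions at work: squaring the factor
  \<open>sqrt 2\<close> gives \<open>2\<close>, which cancels the \<open>1/2\<close> of the mean at
  the node above.\<close>

lemma sum_dyadic_index_norm_sq:
  "(\<Sum>(k, j)\<in>dyadic_index n. (norm (x k j))\<^sup>2) = branch_mean (haar_tree n x) (\<lambda>w. \<Sum>a\<leftarrow>w. (norm a)\<^sup>2)"
proof -
  have "(\<Sum>k = 1..n. \<Sum>j = 1..2 ^ (k - 1). (norm (x k j))\<^sup>2)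
      = branch_mean (haar_tree n x) (\<lambda>w. \<Sum>a\<leftarrow>w. (norm a)\<^sup>2)"
  proof (induction n arbitrary: x)
    case (Suc n)
    let ?g = "\<lambda>k. \<Sum>j = 1..2 ^ (k - 1). (norm (x k j))\<^sup>2"
    have "(\<Sum>k = 1..Suc n. ?g k) = ?g 1 + (\<Sum>k = 1..n. ?g (Suc k))"
      using sum.atLeast_Suc_atMost[of 1 "Suc n" ?g] sum.shift_bounds_cl_Suc_ivl[of ?g 1 n] by simp
    also have "(\<Sum>k = 1..n. ?g (Suc k)) = (\<Sum>k = 1..n. (\<Sum>j = 1..2 ^ (k - 1). (norm (x (Suc k) j))\<^sup>2)
        + (\<Sum>j = 1..2 ^ (k - 1). (norm (x (Suc k) (j + 2 ^ (k - 1))))\<^sup>2))"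
      by (rule sum.cong) (simp_all only: sum_dyadic_split diff_Suc_1 atLeastAtMost_iff)
    finally show ?case
      by (simp add: Suc.IH[symmetric] branch_mean_add power_mult_distrib sum.distrib
          sum_distrib_left[symmetric] del: sum.cl_ivl_Suc One_nat_def)
  qed simp
  then show ?thesis
    unfolding dyadic_index_Sigma by (subst sum.Sigma[symmetric]) simp_all
qed

section \<open>Sparse trees\<close>

text \<open>An inactive node splits into two subtrees, and the better one attains at least the average;
  following it removes the node. Hence only the active nodes count towards the depth.\<close>

lemma ex_haar_tree_branch_mean_ge:
  assumes "\<And>w. F (filter (\<lambda>a. a \<noteq> 0) w) = F w"
    and "\<And>w. w \<in> branches t \<Longrightarrow> length (filter (\<lambda>a. a \<noteq> 0) w) \<le> N"
  shows "\<exists>x. branch_mean t F \<le> branch_mean (haar_tree N x) F"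
  using assms
proof (induction t arbitrary: F N)
  case Leaf
  \<comment> \<open>A leaf may be reached before depth \<open>N\<close>; zero coefficients pad it,
    and \<open>F\<close> does not see them.\<close>
  have "branch_mean (haar_tree N (\<lambda>_ _. 0)) F = F []"
    using Leaf(1)
  proof (induction N arbitrary: F)
    case (Suc N)
    have "F (0 # w) = F w" for w
      using Suc.prems[of "0 # w"] Suc.prems[of w] by simp
    with Suc show ?case by simp
  qed simp
  then show ?case by (intro exI[of _ "\<lambda>_ _. 0"]) simp
next
  case (Node l a r)
  show ?case
  proof (cases "a = 0")
    case True
    have "F (0 # w) = F w" for w
      using Node.prems(1)[of "0 # w"] Node.prems(1)[of w] by simp
    then have mean: "branch_mean (Node l a r) F = (branch_mean l F + branch_mean r F) / 2"
      using True by simp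
    have "\<exists>x. branch_mean l F \<le> branch_mean (haar_tree N x) F"
    proof (rule Node.IH(1))
      show "F (filter (\<lambda>a. a \<noteq> 0) w) = F w" for w
        by (rule Node.prems(1))
      show "length (filter (\<lambda>a. a \<noteq> 0) w) \<le> N" if "w \<in> branches l" for w
        using Node.prems(2) True that by force
    qed
    moreover have "\<exists>x. branch_mean r F \<le> branch_mean (haar_tree N x) F"
    proof (rule Node.IH(2))
      show "F (filter (\<lambda>a. a \<noteq> 0) w) = F w" for w
        by (rule Node.prems(1))
      show "length (filter (\<lambda>a. a \<noteq> 0) w) \<le> N" if "w \<in> branches r" for w
        using Node.prems(2) True that by force
    qed
    moreover have "branch_mean (Node l a r) F \<le> branch_mean l F \<or>
        branch_mean (Node l a r) F \<le> branch_mean r F"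
      unfolding mean by (cases "branch_mean l F \<le> branch_mean r F") simp_all
    ultimately show ?thesis by (meson order_trans)
  next
    case False
    obtain w where "w \<in> branches l" using branches_nonempty by blast
    then have "length (filter (\<lambda>a. a \<noteq> 0) (a # w)) \<le> N"
      by (intro Node.prems(2)) simp
    with False obtain M where N: "N = Suc M" by (cases N) auto
    have "\<exists>x. branch_mean l (\<lambda>w. F (a # w)) \<le> branch_mean (haar_tree M x) (\<lambda>w. F (a # w))"
    proof (rule Node.IH(1))
      show "F (a # filter (\<lambda>a. a \<noteq> 0) w) = F (a # w)" for w
        using Node.prems(1)[of "a # w"] False by simp
      show "length (filter (\<lambda>a. a \<noteq> 0) w) \<le> M" if "w \<in> branches l" for w
        using Node.prems(2)[of "a # w"] that False N by simp
    qed
    then obtain u where u: "branch_mean l (\<lambda>w. F (a # w)) \<le> branch_mean (haar_tree M u) (\<lambda>w. F (a # w))" ..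
    have "\<exists>x. branch_mean r (\<lambda>w. F (- a # w)) \<le> branch_mean (haar_tree M x) (\<lambda>w. F (- a # w))"
    proof (rule Node.IH(2))
      show "F (- a # filter (\<lambda>a. a \<noteq> 0) w) = F (- a # w)" for w
        using Node.prems(1)[of "- a # w"] False by simp
      show "length (filter (\<lambda>a. a \<noteq> 0) w) \<le> M" if "w \<in> branches r" for w
        using Node.prems(2)[of "- a # w"] that False N by simp
    qed
    then obtain v where v: "branch_mean r (\<lambda>w. F (- a # w)) \<le> branch_mean (haar_tree M v) (\<lambda>w. F (- a # w))" ..
    obtain x where "haar_tree (Suc M) x = Node (haar_tree M u) a (haar_tree M v)"
      using ex_haar_tree_Node by blast
    then have "branch_mean (Node l a r) F \<le> branch_mean (haar_tree N x) F"
      using u v unfolding N by simp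
    then show ?thesis by blast
  qed
qed

lemma sum_list_map_filter_nonzero:
  assumes "f 0 = 0"
  shows "sum_list (map f (filter (\<lambda>a. a \<noteq> 0) w)) = sum_list (map f w)"
  by (induction w) (auto simp: assms)

text \<open>Compression compares means of a single functional, hence both sides are first combined
  into \<open>?F\<close>. It ignores zero entries, because both sums in it do.\<close>

lemma sparse_branch_mean_le:
  assumes haar: "\<And>x. branch_mean (haar_tree N x) (\<lambda>w. (norm (T (sum_list w)))\<^sup>2)
      \<le> D * branch_mean (haar_tree N x) (\<lambda>w. \<Sum>a\<leftarrow>w. (norm a)\<^sup>2)"
    and sparse: "\<And>w. w \<in> branches t \<Longrightarrow> length (filter (\<lambda>a. a \<noteq> 0) w) \<le> N"
  shows "branch_mean t (\<lambda>w. (norm (T (sum_list w)))\<^sup>2) \<le> D * branch_mean t (\<lambda>w. \<Sum>a\<leftarrow>w. (norm a)\<^sup>2)"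
proof -
  let ?F = "\<lambda>w. (norm (T (sum_list w)))\<^sup>2 - D * (\<Sum>a\<leftarrow>w. (norm a)\<^sup>2)"
  have mean: "branch_mean s ?F = branch_mean s (\<lambda>w. (norm (T (sum_list w)))\<^sup>2)
      - D * branch_mean s (\<lambda>w. \<Sum>a\<leftarrow>w. (norm a)\<^sup>2)" for s
    by (simp add: branch_mean_diff branch_mean_cmult)
  have "?F (filter (\<lambda>a. a \<noteq> 0) w) = ?F w" for w
    using sum_list_map_filter_nonzero[of "\<lambda>a. a" w]
      sum_list_map_filter_nonzero[of "\<lambda>a. (norm a)\<^sup>2" w] by simp
  then have "\<exists>x. branch_mean t ?F \<le> branch_mean (haar_tree N x) ?F"
    using sparse by (rule ex_haar_tree_branch_mean_ge)
  then obtain x where "branch_mean t ?F \<le> branch_mean (haar_tree N x) ?F" ..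
  then show ?thesis
    using haar[of x] unfolding mean by linarith
qed

section \<open>Splitting a bounded tree into levels of comparable node size\<close>

lemma sum_list_norm_sq_le:
  assumes "\<And>a. a \<in> set v \<Longrightarrow> norm a \<le> b"
  shows "(\<Sum>a\<leftarrow>v. (norm a)\<^sup>2) \<le> real (length (filter (\<lambda>a. a \<noteq> 0) v)) * b\<^sup>2"
  using assms
proof (induction v)
  case (Cons a v)
  have "(norm a)\<^sup>2 \<le> b\<^sup>2" using Cons.prems[of a] by (intro power_mono) auto
  with Cons show ?case by (auto simp: algebra_simps)
qed simp

lemma length_filter_nonzero_le:
  fixes e p :: real
  assumes "\<And>a. a \<in> set v \<Longrightarrow> a \<noteq> 0 \<Longrightarrow> e \<le> norm a powr p"
  shows "real (length (filter (\<lambda>a. a \<noteq> 0) v)) * e \<le> (\<Sum>a\<leftarrow>v. norm a powr p)"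
  using assms
proof (induction v)
  case (Cons a v)
  have "real (length (filter (\<lambda>a. a \<noteq> 0) v)) * e \<le> (\<Sum>a\<leftarrow>v. norm a powr p)"
    by (rule Cons.IH) (auto intro: Cons.prems)
  moreover have "e \<le> norm a powr p" if "a \<noteq> 0"
    using that by (auto intro: Cons.prems)
  ultimately show ?case by (auto simp: algebra_simps)
qed simp

text \<open>The source of the logarithm: Cauchy-Schwarz over the \<open>M + 1\<close> pieces costs
  one factor \<open>M + 1\<close>, adding up their bounds another; after a square root one of them
  is left.\<close>

lemma branch_mean_sum_dominated:
  fixes g :: "nat \<Rightarrow> 'a::real_vector \<Rightarrow> 'a" and T :: "'a \<Rightarrow> 'b::real_normed_vector"
  assumes "linear T"
    and odd: "\<And>m a. g m (- a) = - g m a"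
    and split: "\<And>w. w \<in> branches t \<Longrightarrow> sum_list w = (\<Sum>m\<le>M. sum_list (map (g m) w))"
    and bound: "\<And>m. m \<le> M \<Longrightarrow> branch_mean (map_tree (g m) t) (\<lambda>w. (norm (T (sum_list w)))\<^sup>2) \<le> B"
  shows "branch_mean t (\<lambda>w. (norm (T (sum_list w)))\<^sup>2) \<le> (real M + 1)\<^sup>2 * B"
proof -
  have "branch_mean t (\<lambda>w. (norm (T (sum_list w)))\<^sup>2)
      \<le> branch_mean t (\<lambda>w. (real M + 1) * (\<Sum>m\<le>M. (norm (T (sum_list (map (g m) w))))\<^sup>2))"
  proof (rule branch_mean_mono)
    fix w assume "w \<in> branches t"
    then have "T (sum_list w) = (\<Sum>m\<le>M. T (sum_list (map (g m) w)))"
      by (simp add: split linear_sum[OF assms(1)])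
    then have "(norm (T (sum_list w)))\<^sup>2 \<le> (\<Sum>m\<le>M. norm (T (sum_list (map (g m) w))))\<^sup>2"
      by (simp add: norm_sum power_mono)
    also have "\<dots> \<le> (real M + 1) * (\<Sum>m\<le>M. (norm (T (sum_list (map (g m) w))))\<^sup>2)"
      using sum_squared_le_sum_of_squares[of "\<lambda>m. norm (T (sum_list (map (g m) w)))" "{..M}"]
      by (simp add: algebra_simps)
    finally show "(norm (T (sum_list w)))\<^sup>2 \<le> (real M + 1) * (\<Sum>m\<le>M. (norm (T (sum_list (map (g m) w))))\<^sup>2)" .
  qed
  also have "\<dots> = (real M + 1) * (\<Sum>m\<le>M. branch_mean (map_tree (g m) t) (\<lambda>w. (norm (T (sum_list w)))\<^sup>2))"
    by (simp add: branch_mean_cmult branch_mean_sum branch_mean_map_tree odd)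
  also have "\<dots> \<le> (real M + 1) * (\<Sum>m\<le>M. B)"
    by (intro mult_left_mono sum_mono bound) auto
  also have "\<dots> = (real M + 1)\<^sup>2 * B"
    by (simp add: power2_eq_square)
  finally show ?thesis .
qed

text \<open>Nodes of size about \<open>r * 2 powr (- m / p)\<close> occur at most \<open>2 ^ (m + 1)\<close> times on each branch, so
  the weak type inequality for that depth bounds each of the \<open>M + 1\<close> levels by a multiple of \<open>r\<^sup>2\<close>.\<close>

lemma bounded_tree_branch_mean_le:
  fixes T :: "'a::real_normed_vector \<Rightarrow> 'b::real_normed_vector" and p r C :: real
  assumes "linear T" and p: "1 \<le> p" and r: "0 < r" and C: "0 \<le> C"
    and haar: "\<And>N x. 1 \<le> N \<Longrightarrow> branch_mean (haar_tree N x) (\<lambda>w. (norm (T (sum_list w)))\<^sup>2)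
      \<le> C * real N powr (2 / p - 1) * branch_mean (haar_tree N x) (\<lambda>w. \<Sum>a\<leftarrow>w. (norm a)\<^sup>2)"
    and len: "\<And>w. w \<in> branches t \<Longrightarrow> length w \<le> 2 ^ M"
    and bdd: "\<And>w. w \<in> branches t \<Longrightarrow> (\<Sum>a\<leftarrow>w. norm a powr p) \<le> r powr p"
  shows "branch_mean t (\<lambda>w. (norm (T (sum_list w)))\<^sup>2) \<le> (real M + 1)\<^sup>2 * (4 * C * r\<^sup>2)"
proof -
  \<comment> \<open>The \<open>p\<close>-th powers of the thresholds halve from level to level:
    \<open>\<theta> m powr p = r powr p / 2 ^ m\<close>.\<close>
  define \<theta> where "\<theta> m = r * 2 powr (- real m / p)" for m :: nat
  \<comment> \<open>The alternative \<open>M \<le> m\<close> makes the least index exist; level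
    \<open>M\<close> collects every value of norm at most \<open>\<theta> M\<close>, including
    \<open>0\<close>.\<close>
  define lev where "lev a = (LEAST m. M \<le> m \<or> \<theta> (Suc m) < norm a)" for a :: 'a
  define g where "g m a = (if lev a = m then a else 0)" for m and a :: 'a
  have lev_le: "lev a \<le> M" for a
    unfolding lev_def by (rule Least_le) simp
  have lev_gt: "\<theta> (Suc (lev a)) < norm a" if "lev a < M" for a
    using LeastI[of "\<lambda>m. M \<le> m \<or> \<theta> (Suc m) < norm a" M] that unfolding lev_def by simp
  have norm_le: "norm a \<le> \<theta> (lev a)" if "norm a \<le> r" for a
  proof (cases "lev a")
    case 0
    then show ?thesis using that by (simp add: \<theta>_def)
  next
    case (Suc m)
    then have "\<not> (M \<le> m \<or> \<theta> (Suc m) < norm a)"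
      using not_less_Least[of m "\<lambda>m. M \<le> m \<or> \<theta> (Suc m) < norm a"] unfolding lev_def by simp
    then show ?thesis using Suc by simp
  qed
  have powr_le: "norm a powr p \<le> (\<Sum>a\<leftarrow>w. norm a powr p)" if "a \<in> set w" for a and w :: "'a list"
    using that by (intro member_le_sum_list) auto
  have lev_minus: "lev (- a) = lev a" for a by (simp add: lev_def)
  show ?thesis
  proof (rule branch_mean_sum_dominated[where g = g])
    show odd: "g m (- a) = - g m a" for m a by (simp add: g_def lev_minus)
    show "sum_list w = (\<Sum>m\<le>M. sum_list (map (g m) w))" for w
    proof (induction w)
      case (Cons a w)
      have "(\<Sum>m\<le>M. g m a) = a" using lev_le by (simp add: g_def)
      with Cons show ?case by (simp add: sum.distrib)
    qed simp
    fix m assume m: "m \<le> M"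
    have nodes: "norm b \<le> \<theta> m" if w: "w \<in> branches t" and b: "b \<in> set (map (g m) w)" for w b
    proof -
      from b obtain a where a: "a \<in> set w" "b = g m a" by auto
      have "norm a powr p \<le> r powr p"
        using powr_le[OF a(1)] bdd[OF w] by simp
      then have "norm a \<le> r"
        using p r powr_less_mono2[of p r "norm a"] by (auto simp: not_less[symmetric])
      then show ?thesis
        using norm_le[of a] a(2) r by (auto simp: g_def \<theta>_def)
    qed
    have count: "length (filter (\<lambda>a. a \<noteq> 0) (map (g m) w)) \<le> 2 ^ Suc m" if w: "w \<in> branches t" for w
    \<comment> \<open>The last level has no lower bound on the size of its values, but there the
      length of the branch suffices. On the other levels each nonzero value uses up at least
      \<open>r powr p / 2 ^ Suc m\<close> of the total \<open>r powr p\<close>.\<close>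
    proof (cases "m = M")
      case True
      have "length (filter (\<lambda>a. a \<noteq> 0) (map (g m) w)) \<le> length w"
        by (metis length_filter_le length_map)
      also have "\<dots> \<le> 2 ^ m" using len[OF w] True by simp
      also have "\<dots> \<le> 2 ^ Suc m" by simp
      finally show ?thesis .
    next
      case False
      let ?e = "\<theta> (Suc m) powr p"
      have e: "?e = r powr p / 2 ^ Suc m"
      proof -
        have "2 powr (- real (Suc m)) = 1 / (2::real) ^ Suc m"
          by (simp only: powr_minus_divide powr_realpow zero_less_numeral)
        then show ?thesis
          using p r by (simp add: \<theta>_def powr_mult powr_powr del: of_nat_Suc power_Suc)
      qed
      have "real (length (filter (\<lambda>a. a \<noteq> 0) (map (g m) w))) * ?e \<le> (\<Sum>a\<leftarrow>map (g m) w. norm a powr p)"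
      proof (rule length_filter_nonzero_le)
        fix b assume "b \<in> set (map (g m) w)" "b \<noteq> 0"
        then obtain a where "lev a = m" "b = a" by (auto simp: g_def split: if_splits)
        then have "\<theta> (Suc m) < norm b" using lev_gt m False by auto
        then show "?e \<le> norm b powr p"
          using p r by (intro powr_mono2) (auto simp: \<theta>_def)
      qed
      also have "\<dots> \<le> (\<Sum>a\<leftarrow>w. norm a powr p)"
        unfolding map_map by (rule sum_list_mono) (simp add: g_def)
      also have "\<dots> \<le> r powr p" by (rule bdd[OF w])
      finally have "real (length (filter (\<lambda>a. a \<noteq> 0) (map (g m) w))) \<le> 2 ^ Suc m"
        unfolding e using r by (simp add: field_simps del: filter_map length_map)
      then show ?thesis by (metis of_nat_le_iff of_nat_numeral of_nat_power)
    qed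
    let ?N = "2 ^ Suc m :: nat"
    have "branch_mean (map_tree (g m) t) (\<lambda>w. (norm (T (sum_list w)))\<^sup>2)
        \<le> C * real ?N powr (2 / p - 1) * branch_mean (map_tree (g m) t) (\<lambda>w. \<Sum>a\<leftarrow>w. (norm a)\<^sup>2)"
    proof (rule sparse_branch_mean_le[OF haar])
      show "length (filter (\<lambda>a. a \<noteq> 0) w) \<le> ?N" if "w \<in> branches (map_tree (g m) t)" for w
        using that count unfolding branches_map_tree[of "g m", OF odd] by blast
    qed simp
    also have "\<dots> \<le> C * real ?N powr (2 / p - 1) * branch_mean (map_tree (g m) t) (\<lambda>w. real ?N * (\<theta> m)\<^sup>2)"
    proof (intro mult_left_mono branch_mean_mono)
      fix v assume "v \<in> branches (map_tree (g m) t)"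
      then obtain w where w: "w \<in> branches t" "v = map (g m) w"
        unfolding branches_map_tree[of "g m", OF odd] by blast
      have "(\<Sum>a\<leftarrow>v. (norm a)\<^sup>2) \<le> real (length (filter (\<lambda>a. a \<noteq> 0) v)) * (\<theta> m)\<^sup>2"
        using nodes[OF w(1)] w(2) by (intro sum_list_norm_sq_le) auto
      also have "\<dots> \<le> real ?N * (\<theta> m)\<^sup>2"
        using count[OF w(1)] unfolding w(2) by (intro mult_right_mono of_nat_mono) auto
      finally show "(\<Sum>a\<leftarrow>v. (norm a)\<^sup>2) \<le> real ?N * (\<theta> m)\<^sup>2" .
    qed (use C in auto)
    also have "\<dots> = C * (real ?N powr (2 / p - 1) * real ?N * (\<theta> m)\<^sup>2)"
      by simp
    \<comment> \<open>\<open>?N powr (2 / p)\<close> grows like \<open>2 powr (2 * m / p)\<close>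
      and \<open>(\<theta> m)\<^sup>2\<close> decays at the same rate, so \<open>m\<close> cancels:
      the exponent of weak type \<open>p\<close> fits exactly.\<close>
    also have "real ?N powr (2 / p - 1) * real ?N * (\<theta> m)\<^sup>2 = 2 powr (2 / p) * r\<^sup>2"
    proof -
      have N: "real ?N = 2 powr (real m + 1)"
        by (simp add: powr_add powr_realpow)
      have "real ?N powr (2 / p - 1) * real ?N = 2 powr ((real m + 1) * (2 / p - 1) + (real m + 1))"
        unfolding N powr_powr powr_add[symmetric] by (simp only: mult.commute)
      moreover have "(\<theta> m)\<^sup>2 = r\<^sup>2 * 2 powr (- 2 * real m / p)"
        by (simp add: \<theta>_def power_mult_distrib powr_power mult.commute)
      ultimately have "real ?N powr (2 / p - 1) * real ?N * (\<theta> m)\<^sup>2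
          = r\<^sup>2 * 2 powr ((real m + 1) * (2 / p - 1) + (real m + 1) + - 2 * real m / p)"
        by (simp only: powr_add mult_ac)
      also have "(real m + 1) * (2 / p - 1) + (real m + 1) + - 2 * real m / p = 2 / p"
        using p by (simp add: field_simps)
      finally show ?thesis by simp
    qed
    also have "C * (2 powr (2 / p) * r\<^sup>2) \<le> C * (4 * r\<^sup>2)"
    proof -
      have "2 powr (2 / p) \<le> (2::real) powr 2"
        using p by (intro powr_mono) (auto simp: field_simps)
      then have "2 powr (2 / p) \<le> (4::real)" by simp
      then show ?thesis using C by (intro mult_left_mono mult_right_mono) auto
    qed
    finally show "branch_mean (map_tree (g m) t) (\<lambda>w. (norm (T (sum_list w)))\<^sup>2) \<le> 4 * C * r\<^sup>2"
      by simp
  qed (rule assms(1))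
qed

section \<open>The good-lambda inequality\<close>

primrec max_partial_norm :: "('a \<Rightarrow> 'b::real_normed_vector) \<Rightarrow> 'b \<Rightarrow> 'a list \<Rightarrow> real" where
  "max_partial_norm T y [] = norm y"
| "max_partial_norm T y (a # w) = max (norm y) (max_partial_norm T (y + T a) w)"

lemma norm_le_max_partial_norm: "norm y \<le> max_partial_norm T y w"
  by (cases w) auto

lemma max_partial_norm_nonneg: "0 \<le> max_partial_norm T y w"
  using norm_ge_zero[of y] norm_le_max_partial_norm[of y T w] by linarith

lemma norm_sum_list_le_max_partial_norm:
  assumes "linear T"
  shows "norm (y + T (sum_list w)) \<le> max_partial_norm T y w"
proof (induction w arbitrary: y)
  case Nil
  then show ?case by (simp add: linear_0[OF assms])
next
  case (Cons a w)
  show ?case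
    using Cons[of "y + T a"] by (simp add: linear_add[OF assms] add.assoc le_max_iff_disj)
qed

lemma max_partial_norm_add_le: "max_partial_norm T (y + z) w \<le> norm y + max_partial_norm T z w"
proof (induction w arbitrary: z)
  case Nil
  then show ?case by (simp add: norm_triangle_ineq)
next
  case (Cons a w)
  have "norm (y + z) \<le> norm y + norm z" by (rule norm_triangle_ineq)
  then show ?case
    using Cons[of "z + T a"] by (auto simp: add.assoc)
qed

text \<open>The squared norm of a martingale is a submartingale: \<open>y\<close> is the midpoint of
  \<open>y + T a\<close> and \<open>y - T a\<close>, and the squared norm is convex.\<close>

lemma norm_sq_le_branch_mean:
  fixes T :: "'a::real_vector \<Rightarrow> 'b::real_normed_vector"
  assumes "linear T"
  shows "(norm y)\<^sup>2 \<le> branch_mean t (\<lambda>w. (norm (y + T (sum_list w)))\<^sup>2)"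
proof (induction t arbitrary: y)
  case Leaf
  then show ?case by (simp add: linear_0[OF assms])
next
  case (Node l a r)
  have "2 * norm y \<le> norm (y + T a) + norm (y - T a)"
    using norm_triangle_ineq[of "y + T a" "y - T a"] by (simp add: scaleR_2[symmetric])
  then have "(2 * norm y)\<^sup>2 \<le> (norm (y + T a) + norm (y - T a))\<^sup>2"
    by (intro power_mono) auto
  also have "\<dots> \<le> 2 * ((norm (y + T a))\<^sup>2 + (norm (y - T a))\<^sup>2)"
    using sum_squares_bound[of "norm (y + T a)" "norm (y - T a)"] by (simp add: power2_sum)
  finally have "(norm y)\<^sup>2 \<le> ((norm (y + T a))\<^sup>2 + (norm (y - T a))\<^sup>2) / 2"
    by (simp add: power_mult_distrib)
  with Node.IH(1)[of "y + T a"] Node.IH(2)[of "y - T a"] show ?case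
    by (simp add: linear_add[OF assms] linear_neg[OF assms] linear_diff[OF assms] algebra_simps)
qed

text \<open>Doob's weak type inequality. A branch is followed until the norm first exceeds
  \<open>\<gamma>\<close>; from that node on, \<open>norm_sq_le_branch_mean\<close> bounds the mean
  of the final square below by \<open>\<gamma>\<^sup>2\<close>.\<close>

lemma max_partial_norm_weak_type:
  fixes T :: "'a::real_vector \<Rightarrow> 'b::real_normed_vector"
  assumes "linear T" "0 \<le> \<gamma>"
  shows "branch_mean t (\<lambda>w. of_bool (\<gamma> < max_partial_norm T y w)) * \<gamma>\<^sup>2
    \<le> branch_mean t (\<lambda>w. (norm (y + T (sum_list w)))\<^sup>2)"
proof (induction t arbitrary: y)
  case Leaf
  then show ?case using assms(2) by (simp add: linear_0[OF assms(1)] power_mono)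
next
  case (Node l a r)
  show ?case
  proof (cases "\<gamma> < norm y")
    case True
    have "branch_mean (Node l a r) (\<lambda>w. of_bool (\<gamma> < max_partial_norm T y w)) \<le> branch_mean (Node l a r) (\<lambda>_. 1)"
      by (rule branch_mean_mono) simp
    then have "branch_mean (Node l a r) (\<lambda>w. of_bool (\<gamma> < max_partial_norm T y w)) * \<gamma>\<^sup>2 \<le> 1 * (norm y)\<^sup>2"
      using True assms(2) by (intro mult_mono power_mono) auto
    also have "\<dots> \<le> branch_mean (Node l a r) (\<lambda>w. (norm (y + T (sum_list w)))\<^sup>2)"
      unfolding mult_1 by (rule norm_sq_le_branch_mean[OF assms(1)])
    finally show ?thesis .
  next
    case False
    with Node.IH(1)[of "y + T a"] Node.IH(2)[of "y - T a"] show ?thesis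
      by (simp add: less_max_iff_disj linear_add[OF assms(1)] linear_neg[OF assms(1)]
          linear_diff[OF assms(1)] algebra_simps)
  qed
qed

text \<open>The test precedes the node and depends only on the norm shared by its two halves. Hence
  the result is again a tree of signed differences, and for \<open>0 \<le> s\<close> the sum of
  \<open>p\<close>-th powers never overshoots \<open>s\<close>.\<close>

primrec stopped :: "real \<Rightarrow> real \<Rightarrow> 'a::real_normed_vector tree \<Rightarrow> 'a tree" where
  "stopped p s Leaf = Leaf"
| "stopped p s (Node l a r) = (if norm a powr p \<le> s
     then Node (stopped p (s - norm a powr p) l) a (stopped p (s - norm a powr p) r) else Leaf)"

lemma sum_list_powr_nonneg: "0 \<le> (\<Sum>a\<leftarrow>w. norm a powr p)"
  by (rule sum_list_nonneg) auto

lemma sum_list_powr_stopped_le: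
  "0 \<le> s \<Longrightarrow> w \<in> branches (stopped p s t) \<Longrightarrow> (\<Sum>a\<leftarrow>w. norm a powr p) \<le> s"
proof (induction t arbitrary: s w)
  case (Node l a r)
  show ?case
  proof (cases "norm a powr p \<le> s")
    case True
    then obtain b v where "w = b # v" "norm b = norm a"
      and "v \<in> branches (stopped p (s - norm a powr p) l) \<or> v \<in> branches (stopped p (s - norm a powr p) r)"
      using Node.prems(2) by auto
    then show ?thesis
      using Node.IH[of "s - norm a powr p" v] True by auto
  qed (use Node.prems in simp)
qed simp

lemma length_stopped_le:
  "(\<And>w. w \<in> branches t \<Longrightarrow> length w \<le> n) \<Longrightarrow> w \<in> branches (stopped p s t) \<Longrightarrow> length w \<le> n"
proof (induction t arbitrary: s w n)
  case (Node l a r)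
  show ?case
  proof (cases w)
    case (Cons b v)
    obtain w' where "w' \<in> branches l" using branches_nonempty by blast
    then have "Suc (length w') \<le> n" using Node.prems(1)[of "a # w'"] by simp
    then obtain m where n: "n = Suc m" by (cases n) auto
    have "length u \<le> m" if "u \<in> branches l" for u
      using Node.prems(1)[of "a # u"] that n by simp
    moreover have "length u \<le> m" if "u \<in> branches r" for u
      using Node.prems(1)[of "- a # u"] that n by simp
    ultimately have "length v \<le> m"
      using Node.prems(2) Node.IH[of m v] Cons by (auto split: if_splits)
    then show ?thesis using Cons n by simp
  qed simp
qed simp

text \<open>A branch whose total is at most \<open>s\<close> is not cut, so both events agree on it;
  all other branches contribute \<open>0\<close> on the left.\<close>

lemma branch_mean_le_stopped:
  "branch_mean t (\<lambda>w. of_bool (\<gamma> < max_partial_norm T y w \<and> (\<Sum>a\<leftarrow>w. norm a powr p) \<le> s))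
    \<le> branch_mean (stopped p s t) (\<lambda>w. of_bool (\<gamma> < max_partial_norm T y w))"
proof (induction t arbitrary: y s)
  case (Node l a r)
  show ?case
  proof (cases "norm a powr p \<le> s")
    case False
    then have "\<not> (\<Sum>b\<leftarrow>a # w. norm b powr p) \<le> s" "\<not> (\<Sum>b\<leftarrow>- a # w. norm b powr p) \<le> s" for w
      using sum_list_powr_nonneg[of p w] by auto
    then show ?thesis using False by simp
  next
    case True
    show ?thesis
    proof (cases "\<gamma> < norm y")
      case gt: True
      have "max_partial_norm T y w > \<gamma>" for w
        using gt norm_le_max_partial_norm[of y T w] by linarith
      then have "branch_mean (stopped p s (Node l a r)) (\<lambda>w. of_bool (\<gamma> < max_partial_norm T y w)) = 1"
        by simp
      moreover have "branch_mean (Node l a r) (\<lambda>w. of_bool (\<gamma> < max_partial_norm T y w \<and> (\<Sum>a\<leftarrow>w. norm a powr p) \<le> s))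
          \<le> branch_mean (Node l a r) (\<lambda>_. 1)"
        by (rule branch_mean_mono) simp
      ultimately show ?thesis by simp
    next
      case False
      with True Node.IH(1)[of "y + T a" "s - norm a powr p"] Node.IH(2)[of "y + T (- a)" "s - norm a powr p"]
      show ?thesis by (simp add: less_max_iff_disj algebra_simps)
    qed
  qed
qed simp

text \<open>Each branch is followed to its first partial sum beyond \<open>\<kappa>\<close>. An
  admissible step moves by at most \<open>A * (\<delta> * \<kappa>) = \<kappa> / 5\<close>, so that
  sum has norm at most \<open>6/5 * \<kappa>\<close>, and passing \<open>3 * \<kappa>\<close> takes
  a further change of more than \<open>\<kappa>\<close>. The factor \<open>1/25\<close> is
  \<open>(A * \<delta>)\<^sup>2\<close>; it has to stay below \<open>1/9\<close> for the later
  absorption.\<close>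

lemma good_lambda:
  fixes T :: "'a::real_normed_vector \<Rightarrow> 'b::real_normed_vector"
  assumes "linear T" and p: "1 \<le> p" and A: "0 < A" and lam: "0 < \<kappa>" and \<delta>: "\<delta> = 1 / (5 * A)"
    and opnorm: "\<And>a. norm (T a) \<le> A * norm a"
    and square: "\<And>t r. 0 < r \<Longrightarrow> (\<And>w. w \<in> branches t \<Longrightarrow> length w \<le> n) \<Longrightarrow>
      (\<And>w. w \<in> branches t \<Longrightarrow> (\<Sum>a\<leftarrow>w. norm a powr p) \<le> r powr p) \<Longrightarrow>
      branch_mean t (\<lambda>w. (norm (T (sum_list w)))\<^sup>2) \<le> (A * r)\<^sup>2"
    and len: "\<And>w. w \<in> branches t \<Longrightarrow> length w \<le> n"
    and y: "norm y \<le> \<kappa>" and s: "s \<le> (\<delta> * \<kappa>) powr p"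
  shows "branch_mean t (\<lambda>w. of_bool (3 * \<kappa> < max_partial_norm T y w \<and> (\<Sum>a\<leftarrow>w. norm a powr p) \<le> s))
    \<le> 1 / 25 * branch_mean t (\<lambda>w. of_bool (\<kappa> < max_partial_norm T y w))"
  using len y s
proof (induction t arbitrary: y s)
  case Leaf
  then show ?case using lam by simp
next
  case (Node l a r)
  let ?P = "\<lambda>t y s. branch_mean t (\<lambda>w. of_bool (3 * \<kappa> < max_partial_norm T y w \<and> (\<Sum>a\<leftarrow>w. norm a powr p) \<le> s))"
  let ?Q = "\<lambda>t y. branch_mean t (\<lambda>w. of_bool (\<kappa> < max_partial_norm T y w))"
  show ?case
  proof (cases "norm a powr p \<le> s")
    case False
    then have "\<not> (\<Sum>b\<leftarrow>a # w. norm b powr p) \<le> s" "\<not> (\<Sum>b\<leftarrow>- a # w. norm b powr p) \<le> s" for w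
      using sum_list_powr_nonneg[of p w] by auto
    moreover have "0 \<le> ?Q (Node l a r) y" by (rule branch_mean_nonneg) simp
    ultimately show ?thesis by simp
  next
    case True
    have d: "0 < \<delta> * \<kappa>" using A lam \<delta> by simp
    have "norm a powr p \<le> (\<delta> * \<kappa>) powr p" using True Node.prems(3) by simp
    then have "norm a \<le> \<delta> * \<kappa>"
      using p d powr_less_mono2[of p "\<delta> * \<kappa>" "norm a"] by (auto simp: not_less[symmetric])
    then have "norm (T a) \<le> A * (\<delta> * \<kappa>)"
      using opnorm[of a] A by (meson mult_left_mono order_trans less_imp_le)
    then have Ta: "norm (T a) \<le> \<kappa> / 5" using A \<delta> by simp
    \<comment> \<open>Below \<open>\<kappa>\<close> the induction hypothesis applies; otherwise the
      first crossing takes place at the root of this subtree, and the mean on the right is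
      \<open>1\<close>.\<close>
    have step: "?P t (y + z) (s - norm a powr p) \<le> 1 / 25 * ?Q t (y + z)"
      if IH: "norm (y + z) \<le> \<kappa> \<Longrightarrow> ?P t (y + z) (s - norm a powr p) \<le> 1 / 25 * ?Q t (y + z)"
        and len: "\<And>w. w \<in> branches t \<Longrightarrow> length w \<le> n" and z: "norm z \<le> \<kappa> / 5" for t z
    proof (cases "norm (y + z) \<le> \<kappa>")
      case gt: False
      text \<open>The maximal function has just passed \<open>\<kappa>\<close>. To pass \<open>3 \<kappa>\<close>, the remaining sums must exceed
        \<open>\<kappa>\<close>, which Chebyshev's inequality controls after stopping.\<close>
      have "\<kappa> < max_partial_norm T (y + z) w" for w
        using gt norm_le_max_partial_norm[of "y + z" T w] by linarith
      then have Q: "?Q t (y + z) = 1" by simp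
      let ?t = "stopped p ((\<delta> * \<kappa>) powr p) t"
      have "branch_mean ?t (\<lambda>w. of_bool (\<kappa> < max_partial_norm T 0 w)) * \<kappa>\<^sup>2
          \<le> branch_mean ?t (\<lambda>w. (norm (0 + T (sum_list w)))\<^sup>2)"
        using lam by (intro max_partial_norm_weak_type[OF assms(1)]) simp
      also have "\<dots> \<le> (A * (\<delta> * \<kappa>))\<^sup>2"
        unfolding add_0
        using d len by (intro square) (auto intro: length_stopped_le sum_list_powr_stopped_le)
      also have "\<dots> = 1 / 25 * \<kappa>\<^sup>2" using A \<delta> by (simp add: power2_eq_square)
      finally have cheb: "branch_mean ?t (\<lambda>w. of_bool (\<kappa> < max_partial_norm T 0 w)) \<le> 1 / 25"
        using lam by simp
      have "?P t (y + z) (s - norm a powr p) \<le>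
          branch_mean t (\<lambda>w. of_bool (\<kappa> < max_partial_norm T 0 w \<and> (\<Sum>a\<leftarrow>w. norm a powr p) \<le> (\<delta> * \<kappa>) powr p))"
      proof (rule branch_mean_mono)
        fix w
        have "max_partial_norm T (y + z) w \<le> norm (y + z) + max_partial_norm T 0 w"
          using max_partial_norm_add_le[of T "y + z" 0 w] by simp
        moreover have "norm (y + z) \<le> \<kappa> + \<kappa> / 5"
          using norm_triangle_ineq[of y z] Node.prems(2) z by linarith
        moreover have "s - norm a powr p \<le> (\<delta> * \<kappa>) powr p"
          using Node.prems(3) powr_ge_zero[of "norm a" p] by linarith
        ultimately show "(of_bool (3 * \<kappa> < max_partial_norm T (y + z) w \<and> (\<Sum>a\<leftarrow>w. norm a powr p) \<le> s - norm a powr p) :: real)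
            \<le> of_bool (\<kappa> < max_partial_norm T 0 w \<and> (\<Sum>a\<leftarrow>w. norm a powr p) \<le> (\<delta> * \<kappa>) powr p)"
          using lam by auto
      qed
      also have "\<dots> \<le> branch_mean ?t (\<lambda>w. of_bool (\<kappa> < max_partial_norm T 0 w))"
        by (rule branch_mean_le_stopped)
      finally show ?thesis using cheb Q by simp
    qed (rule IH)
    have s': "s - norm a powr p \<le> (\<delta> * \<kappa>) powr p"
      using Node.prems(3) powr_ge_zero[of "norm a" p] by linarith
    have len_l: "length w \<le> n" if "w \<in> branches l" for w
      using Node.prems(1)[of "a # w"] that by simp
    have len_r: "length w \<le> n" if "w \<in> branches r" for w
      using Node.prems(1)[of "- a # w"] that by simp
    have "?P l (y + T a) (s - norm a powr p) \<le> 1 / 25 * ?Q l (y + T a)"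
      by (rule step) (use Node.IH(1)[OF len_l _ s'] len_l Ta in auto)
    moreover have "?P r (y + T (- a)) (s - norm a powr p) \<le> 1 / 25 * ?Q r (y + T (- a))"
      by (rule step) (use Node.IH(2)[OF len_r _ s'] len_r Ta in \<open>auto simp: linear_neg[OF assms(1)]\<close>)
    moreover have "?P (Node l a r) y s = (?P l (y + T a) (s - norm a powr p) + ?P r (y + T (- a)) (s - norm a powr p)) / 2"
      using Node.prems(2) lam
      by (simp add: less_max_iff_disj le_diff_eq add.commute[of "norm a powr p"])
    moreover have "?Q (Node l a r) y = (?Q l (y + T a) + ?Q r (y + T (- a))) / 2"
      using Node.prems(2) by (simp add: less_max_iff_disj)
    ultimately show ?thesis by simp
  qed
qed

text \<open>Layer-cake formula for a single number, cut off at \<open>R\<close> so that the integral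
  stays on a bounded interval. The factor \<open>c\<close> serves the thresholds
  \<open>3 * s\<close>, \<open>\<delta> * s\<close> and \<open>s\<close>.\<close>

lemma has_integral_powr_layer:
  fixes p X R c :: real
  assumes p: "1 \<le> p" and "0 < c" "0 \<le> X" "0 \<le> R"
  shows "((\<lambda>s. p * s powr (p - 1) * of_bool (c * s < X)) has_integral (min (X / c) R) powr p) {0..R}"
proof -
  let ?m = "min (X / c) R"
  have m: "0 \<le> ?m" using assms by simp
  have "((\<lambda>s. p * s powr (p - 1)) has_integral p * (?m powr (p - 1 + 1) / (p - 1 + 1))) {0..?m}"
    using p m by (intro has_integral_mult_right has_integral_powr_from_0) auto
  then have "((\<lambda>s. p * s powr (p - 1)) has_integral ?m powr p) {0..?m}"
    using p by simp
  then have "((\<lambda>s. if s \<in> {0..?m} then p * s powr (p - 1) else 0) has_integral ?m powr p) {0..R}"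
    by (subst has_integral_restrict) auto
  then show ?thesis
  proof (rule has_integral_spike_finite[of "{?m}", rotated 2])
    show "p * s powr (p - 1) * of_bool (c * s < X) = (if s \<in> {0..?m} then p * s powr (p - 1) else 0)"
      if "s \<in> {0..R} - {?m}" for s
    proof -
      have "c * s < X \<longleftrightarrow> s < X / c" using assms by (simp add: field_simps)
      with that show ?thesis by (auto simp: min_def split: if_splits)
    qed
  qed simp
qed

text \<open>Integrating the good-lambda inequality against \<open>p * s powr (p - 1)\<close> bounds
  the maximal function by the power sums plus a small multiple of itself, which is absorbed. The
  hypothesis \<open>square\<close> ranges over all trees of bounded depth because it is applied to
  stopped subtrees.\<close>

lemma branch_mean_powr_le:
  fixes T :: "'a::real_normed_vector \<Rightarrow> 'b::real_normed_vector"
  assumes "linear T" and p: "1 \<le> p" "p < 2" and A: "0 < A"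
    and opnorm: "\<And>a. norm (T a) \<le> A * norm a"
    and square: "\<And>t r. 0 < r \<Longrightarrow> (\<And>w. w \<in> branches t \<Longrightarrow> length w \<le> n) \<Longrightarrow>
      (\<And>w. w \<in> branches t \<Longrightarrow> (\<Sum>a\<leftarrow>w. norm a powr p) \<le> r powr p) \<Longrightarrow>
      branch_mean t (\<lambda>w. (norm (T (sum_list w)))\<^sup>2) \<le> (A * r)\<^sup>2"
    and len: "\<And>w. w \<in> branches t \<Longrightarrow> length w \<le> n"
  shows "branch_mean t (\<lambda>w. norm (T (sum_list w)) powr p)
    \<le> 15 * (5 * A) powr p * branch_mean t (\<lambda>w. \<Sum>a\<leftarrow>w. norm a powr p)"
proof -
  define \<delta> where "\<delta> = 1 / (5 * A)"
  have \<delta>: "0 < \<delta>" using A by (simp add: \<delta>_def)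
  define X where "X = max_partial_norm T 0"
  define S where "S w = (\<Sum>a\<leftarrow>w. norm a powr p) powr (1 / p)" for w :: "'a list"
  have X0: "0 \<le> X w" for w unfolding X_def by (rule max_partial_norm_nonneg)
  have S0: "0 \<le> S w" for w by (simp add: S_def)
  have Sp: "S w powr p = (\<Sum>a\<leftarrow>w. norm a powr p)" for w
    using p sum_list_powr_nonneg[of p w] by (simp add: S_def powr_powr)
  let ?h = "\<lambda>s. p * s powr (p - 1)"
  let ?I = "branch_mean t (\<lambda>w. S w powr p)"
  have layer: "((\<lambda>s. ?h s * branch_mean t (\<lambda>w. of_bool (c * s < Z w))) has_integral
      branch_mean t (\<lambda>w. (min (Z w / c) R) powr p)) {0..R}"
    if "0 < c" "0 \<le> R" "\<And>w. 0 \<le> Z w" for c R and Z :: "'a list \<Rightarrow> real"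
    unfolding branch_mean_cmult[symmetric]
    using p that by (intro has_integral_branch_mean has_integral_powr_layer) auto
  have truncated: "branch_mean t (\<lambda>w. (min (X w) R) powr p) \<le> 15 * (5 * A) powr p * ?I" if R: "0 \<le> R" for R
  proof -
    let ?Z = "branch_mean t (\<lambda>w. (min (X w) R) powr p)"
    have pointwise: "branch_mean t (\<lambda>w. of_bool (3 * s < X w)) \<le>
        branch_mean t (\<lambda>w. of_bool (\<delta> * s < S w)) + 1 / 25 * branch_mean t (\<lambda>w. of_bool (1 * s < X w))"
      if s: "0 < s" for s
    proof -
      have "branch_mean t (\<lambda>w. of_bool (3 * s < X w)) \<le> branch_mean t (\<lambda>w. of_bool (\<delta> * s < S w)
          + of_bool (3 * s < max_partial_norm T 0 w \<and> (\<Sum>a\<leftarrow>w. norm a powr p) \<le> (\<delta> * s) powr p))"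
      proof (rule branch_mean_mono)
        fix w
        have "(\<Sum>a\<leftarrow>w. norm a powr p) \<le> (\<delta> * s) powr p" if "S w \<le> \<delta> * s"
          using that p S0 unfolding Sp[symmetric] by (intro powr_mono2) auto
        then show "(of_bool (3 * s < X w) :: real) \<le> of_bool (\<delta> * s < S w)
          + of_bool (3 * s < max_partial_norm T 0 w \<and> (\<Sum>a\<leftarrow>w. norm a powr p) \<le> (\<delta> * s) powr p)"
          by (auto simp: X_def)
      qed
      also have "\<dots> \<le> branch_mean t (\<lambda>w. of_bool (\<delta> * s < S w)) + 1 / 25 * branch_mean t (\<lambda>w. of_bool (1 * s < X w))"
        unfolding branch_mean_add X_def mult_1
        by (intro add_left_mono good_lambda[OF assms(1) p(1) A s \<delta>_def opnorm square len])
          (use s in auto)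
      finally show ?thesis .
    qed
    have "branch_mean t (\<lambda>w. (min (X w / 3) R) powr p) \<le>
        branch_mean t (\<lambda>w. (min (S w / \<delta>) R) powr p) + 1 / 25 * branch_mean t (\<lambda>w. (min (X w / 1) R) powr p)"
    proof (rule has_integral_le)
      show "((\<lambda>s. ?h s * branch_mean t (\<lambda>w. of_bool (3 * s < X w))) has_integral
          branch_mean t (\<lambda>w. (min (X w / 3) R) powr p)) {0..R}"
        using R X0 by (intro layer) auto
      show "((\<lambda>s. ?h s * branch_mean t (\<lambda>w. of_bool (\<delta> * s < S w)) + 1 / 25 * (?h s * branch_mean t (\<lambda>w. of_bool (1 * s < X w))))
          has_integral branch_mean t (\<lambda>w. (min (S w / \<delta>) R) powr p) + 1 / 25 * branch_mean t (\<lambda>w. (min (X w / 1) R) powr p)) {0..R}"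
        using R X0 S0 \<delta> by (intro has_integral_add has_integral_mult_right layer) auto
      fix s :: real assume "s \<in> {0..R}"
      then consider "s = 0" | "0 < s" by fastforce
      then show "?h s * branch_mean t (\<lambda>w. of_bool (3 * s < X w)) \<le>
          ?h s * branch_mean t (\<lambda>w. of_bool (\<delta> * s < S w)) + 1 / 25 * (?h s * branch_mean t (\<lambda>w. of_bool (1 * s < X w)))"
      proof cases
        case 2
        then have "?h s * branch_mean t (\<lambda>w. of_bool (3 * s < X w)) \<le> ?h s * (branch_mean t (\<lambda>w. of_bool (\<delta> * s < S w))
            + 1 / 25 * branch_mean t (\<lambda>w. of_bool (1 * s < X w)))"
          using p by (intro mult_left_mono pointwise) auto
        then show ?thesis by (simp add: algebra_simps)
      qed simp
    qed
    \<comment> \<open>The division by \<open>3\<close> costs \<open>3 powr p \<le> 9\<close>.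
      Keeping the same cutoff \<open>R\<close> on both sides makes the absorption of
      \<open>?Z\<close> possible.\<close>
    moreover have "1 / 9 * ?Z \<le> branch_mean t (\<lambda>w. (min (X w / 3) R) powr p)"
      unfolding branch_mean_cmult[symmetric]
    proof (rule branch_mean_mono)
      fix w
      have "(3::real) powr p \<le> 3 powr 2" using p by (intro powr_mono) auto
      then have "1 / 9 * (min (X w) R) powr p \<le> 1 / 3 powr p * (min (X w) R) powr p"
        by (intro mult_right_mono) (auto simp: field_simps)
      also have "\<dots> = (min (X w) R / 3) powr p"
        using R X0[of w] by (simp add: powr_divide)
      also have "\<dots> \<le> (min (X w / 3) R) powr p"
        using p R X0[of w] by (intro powr_mono2) auto
      finally show "1 / 9 * (min (X w) R) powr p \<le> (min (X w / 3) R) powr p" .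
    qed
    moreover have "branch_mean t (\<lambda>w. (min (S w / \<delta>) R) powr p) \<le> (5 * A) powr p * ?I"
      unfolding branch_mean_cmult[symmetric]
    proof (rule branch_mean_mono)
      fix w
      have "(min (S w / \<delta>) R) powr p \<le> (S w / \<delta>) powr p"
        using p R S0[of w] \<delta> by (intro powr_mono2) auto
      also have "\<dots> = (5 * A) powr p * S w powr p"
        using A S0[of w] by (simp add: \<delta>_def powr_mult[symmetric] mult.commute)
      finally show "(min (S w / \<delta>) R) powr p \<le> (5 * A) powr p * S w powr p" .
    qed
    \<comment> \<open>The bounds so far give
      \<open>(1/9 - 1/25) * ?Z \<le> (5 * A) powr p * ?I\<close>, where
      \<open>1/9 - 1/25 = 16/225\<close>. Rounding \<open>225/16\<close> up to \<open>15\<close>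
      uses the sign of \<open>?Z\<close>.\<close>
    moreover have "0 \<le> ?Z" by (rule branch_mean_nonneg) simp
    ultimately show ?thesis by simp
  qed
  have "eventually (\<lambda>R. branch_mean t (\<lambda>w. (min (X w) R) powr p) = branch_mean t (\<lambda>w. X w powr p)) at_top"
  proof (rule eventually_branch_mean_eq)
    show "eventually (\<lambda>R. (min (X w) R) powr p = X w powr p) at_top" for w
      using eventually_ge_at_top[of "X w"] by eventually_elim (simp add: min_absorb1)
  qed
  with eventually_ge_at_top[of "0::real"]
  have "eventually (\<lambda>R. 0 \<le> R \<and> branch_mean t (\<lambda>w. (min (X w) R) powr p) = branch_mean t (\<lambda>w. X w powr p)) at_top"
    by (rule eventually_conj)
  then obtain R where R: "0 \<le> R" "branch_mean t (\<lambda>w. (min (X w) R) powr p) = branch_mean t (\<lambda>w. X w powr p)"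
    using eventually_happens'[OF trivial_limit_at_top_linorder] by blast
  have "branch_mean t (\<lambda>w. norm (T (sum_list w)) powr p) \<le> branch_mean t (\<lambda>w. X w powr p)"
    using p norm_sum_list_le_max_partial_norm[OF assms(1), of 0]
    by (intro branch_mean_mono powr_mono2) (auto simp: X_def)
  also have "\<dots> \<le> 15 * (5 * A) powr p * ?I" using truncated[OF R(1)] unfolding R(2) .
  finally show ?thesis by (simp add: Sp)
qed


section \<open>Haar type ideal norms\<close>

lemma Lq_norm_2_haar_image:
  assumes "linear T"
  shows "Lq_norm 2 (\<lambda>t. \<Sum>(k, j)\<in>dyadic_index n. haar k j t *\<^sub>R T (x k j)) =
    sqrt (branch_mean (haar_tree n x) (\<lambda>w. (norm (T (sum_list w)))\<^sup>2))"
proof -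
  have "norm a powr 2 = (norm a)\<^sup>2" for a :: 'b
    by (cases "a = 0") simp_all
  then show ?thesis
    unfolding Lq_norm_haar_image[OF assms]
    by (simp add: powr_half_sqrt branch_mean_nonneg)
qed

text \<open>\<open>Inf\<close> of an empty set carries no information, so an admissible constant is
  needed before a bound on \<open>haar_tau\<close> yields an inequality. The crude
  \<open>K * sqrt n\<close> comes from Cauchy-Schwarz over the \<open>n\<close> levels.\<close>

lemma haar_tau_set_nonempty:
  fixes T :: "'a::real_normed_vector \<Rightarrow> 'b::real_normed_vector"
  assumes "bounded_linear T"
  shows "{c. 0 \<le> c \<and> (\<forall>x :: nat \<Rightarrow> nat \<Rightarrow> 'a.
     Lq_norm 2 (\<lambda>t. \<Sum>(k, j)\<in>dyadic_index n. haar k j t *\<^sub>R T (x k j))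
     \<le> c * sqrt (\<Sum>(k, j)\<in>dyadic_index n. (norm (x k j))\<^sup>2))} \<noteq> {}"
proof -
  interpret bounded_linear T by fact
  obtain K where K: "0 \<le> K" "\<And>a. norm (T a) \<le> norm a * K"
    using nonneg_bounded by blast
  have "Lq_norm 2 (\<lambda>t. \<Sum>(k, j)\<in>dyadic_index n. haar k j t *\<^sub>R T (x k j))
     \<le> K * sqrt n * sqrt (\<Sum>(k, j)\<in>dyadic_index n. (norm (x k j))\<^sup>2)" for x
  proof -
    have "branch_mean (haar_tree n x) (\<lambda>w. (norm (T (sum_list w)))\<^sup>2)
        \<le> branch_mean (haar_tree n x) (\<lambda>w. K\<^sup>2 * n * (\<Sum>a\<leftarrow>w. (norm a)\<^sup>2))"
    proof (rule branch_mean_mono)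
      fix w assume "w \<in> branches (haar_tree n x)"
      then have len: "length w = n" by (rule length_branches_haar_tree)
      have "norm (sum_list w) \<le> (\<Sum>i<n. norm (w ! i))"
        using norm_sum[of "\<lambda>i. w ! i" "{..<n}"] by (simp add: sum_list_sum_nth len atLeast0LessThan)
      then have "(norm (sum_list w))\<^sup>2 \<le> (\<Sum>i<n. norm (w ! i))\<^sup>2"
        by (intro power_mono) auto
      also have "\<dots> \<le> n * (\<Sum>i<n. (norm (w ! i))\<^sup>2)"
        using sum_squared_le_sum_of_squares[of "\<lambda>i. norm (w ! i)" "{..<n}"] by (simp add: mult.commute)
      also have "(\<Sum>i<n. (norm (w ! i))\<^sup>2) = (\<Sum>a\<leftarrow>w. (norm a)\<^sup>2)"
        by (simp add: sum_list_sum_nth len atLeast0LessThan)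
      finally have "K\<^sup>2 * (norm (sum_list w))\<^sup>2 \<le> K\<^sup>2 * (n * (\<Sum>a\<leftarrow>w. (norm a)\<^sup>2))"
        by (intro mult_left_mono) auto
      moreover have "(norm (T (sum_list w)))\<^sup>2 \<le> (norm (sum_list w) * K)\<^sup>2"
        by (intro power_mono K) auto
      ultimately show "(norm (T (sum_list w)))\<^sup>2 \<le> K\<^sup>2 * n * (\<Sum>a\<leftarrow>w. (norm a)\<^sup>2)"
        by (simp add: power_mult_distrib mult_ac)
    qed
    from real_sqrt_le_mono[OF this] show ?thesis
      unfolding Lq_norm_2_haar_image[OF linear_axioms] sum_dyadic_index_norm_sq branch_mean_cmult
      using K(1) by (simp add: real_sqrt_mult)
  qed
  then show ?thesis using K(1) by (auto intro!: exI[of _ "K * sqrt n"])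
qed

text \<open>A strict bound on the infimum provides an admissible \<open>d < c\<close>, so the
  infimum need not be shown to be attained.\<close>

lemma haar_tau_less_imp:
  fixes T :: "'a::real_normed_vector \<Rightarrow> 'b::real_normed_vector"
  assumes "bounded_linear T" "haar_tau T n < c"
  shows "branch_mean (haar_tree n x) (\<lambda>w. (norm (T (sum_list w)))\<^sup>2)
    \<le> c\<^sup>2 * branch_mean (haar_tree n x) (\<lambda>w. \<Sum>a\<leftarrow>w. (norm a)\<^sup>2)"
proof -
  obtain d where d: "0 \<le> d" "d < c" and le: "Lq_norm 2 (\<lambda>t. \<Sum>(k, j)\<in>dyadic_index n. haar k j t *\<^sub>R T (x k j))
     \<le> d * sqrt (\<Sum>(k, j)\<in>dyadic_index n. (norm (x k j))\<^sup>2)"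
    using cInf_lessD[OF haar_tau_set_nonempty[OF assms(1)] assms(2)[unfolded haar_tau_def]] by blast
  let ?I = "branch_mean (haar_tree n x) (\<lambda>w. \<Sum>a\<leftarrow>w. (norm a)\<^sup>2)"
  have I: "0 \<le> ?I" by (intro branch_mean_nonneg sum_list_nonneg) auto
  have lhs: "0 \<le> branch_mean (haar_tree n x) (\<lambda>w. (norm (T (sum_list w)))\<^sup>2)"
    by (intro branch_mean_nonneg) auto
  have "sqrt (branch_mean (haar_tree n x) (\<lambda>w. (norm (T (sum_list w)))\<^sup>2)) \<le> d * sqrt ?I"
    using le unfolding Lq_norm_2_haar_image[OF bounded_linear.linear[OF assms(1)]] sum_dyadic_index_norm_sq .
  then have "(sqrt (branch_mean (haar_tree n x) (\<lambda>w. (norm (T (sum_list w)))\<^sup>2)))\<^sup>2 \<le> (d * sqrt ?I)\<^sup>2"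
    using lhs by (intro power_mono) auto
  then have "branch_mean (haar_tree n x) (\<lambda>w. (norm (T (sum_list w)))\<^sup>2) \<le> d\<^sup>2 * ?I"
    using lhs I by (simp add: power_mult_distrib)
  also have "\<dots> \<le> c\<^sup>2 * ?I"
    using d I by (intro mult_right_mono power_mono) auto
  finally show ?thesis .
qed

lemma haar_tau_q_le:
  fixes T :: "'a::real_normed_vector \<Rightarrow> 'b::real_normed_vector"
  assumes "linear T" "0 < q" "0 \<le> c"
    and "\<And>x. (branch_mean (haar_tree n x) (\<lambda>w. norm (T (sum_list w)) powr q)) powr (1 / q)
      \<le> c * (branch_mean (haar_tree n x) (\<lambda>w. \<Sum>a\<leftarrow>w. norm a powr q)) powr (1 / q)"
  shows "haar_tau_q q T n \<le> c"
  unfolding haar_tau_q_def sum_Lq_norm_haar_diff[OF assms(2)] Lq_norm_haar_image[OF assms(1)]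
  using assms(3,4) by (intro cInf_lower) (auto intro: bdd_belowI[of _ 0])

text \<open>Rounding up the binary logarithm gives \<open>M + 1 \<le> log 2 n + 2\<close>, and
  \<open>2 * ln 2 \<ge> 1\<close> converts to natural logarithms.\<close>

lemma ex_dyadic_bound:
  assumes "1 \<le> n"
  shows "\<exists>M. n \<le> 2 ^ M \<and> real M + 1 \<le> 2 * (1 + ln (real n))"
proof -
  define M where "M = nat \<lceil>log 2 (real n)\<rceil>"
  have log0: "0 \<le> log 2 (real n)" using assms by simp
  have "real n = 2 powr (log 2 (real n))" using assms by simp
  also have "\<dots> \<le> 2 powr (real M)"
    unfolding M_def by (intro powr_mono) linarith+
  also have "\<dots> = real (2 ^ M)" by (simp add: powr_realpow)
  finally have "n \<le> 2 ^ M" by (simp only: of_nat_le_iff)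
  moreover have "log 2 (real n) \<le> 2 * ln (real n)"
  proof -
    have "1 \<le> 2 * ln (2::real)" using ln2_ge_two_thirds by simp
    then have "ln (real n) * 1 \<le> ln (real n) * (2 * ln 2)"
      using assms by (intro mult_left_mono) auto
    then show ?thesis by (simp add: log_def field_simps)
  qed
  moreover have "real M \<le> log 2 (real n) + 1" using log0 unfolding M_def by linarith
  ultimately show ?thesis by (intro exI[of _ M]) auto
qed

theorem theorem5p6:
  fixes T :: "'a::banach \<Rightarrow> 'b::banach" and p :: real
  assumes "bounded_linear T"
    and "1 \<le> p" and "p < 2"
    and "weak_haar_type p T"
  shows "\<exists>c\<ge>0. \<forall>n::nat. n \<ge> 1 \<longrightarrow> haar_tau_q p T n \<le> c * (1 + ln (real n))"
proof -
  interpret bounded_linear T by fact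
  obtain K where K: "0 \<le> K" "\<And>a. norm (T a) \<le> norm a * K"
    using nonneg_bounded by blast
  obtain c where c: "0 \<le> c" "\<And>n. 1 \<le> n \<Longrightarrow> haar_tau T n \<le> c * real n powr (1 / p - 1 / 2)"
    using assms(4) unfolding weak_haar_type_def by blast
  \<comment> \<open>The summand \<open>1\<close> makes \<open>c < D\<close> strict, as
    \<open>haar_tau_less_imp\<close> demands; \<open>K\<close> lets \<open>A\<close> below dominate
    the operator bound.\<close>
  define D where "D = c + K + 1"
  have D: "0 < D" "K \<le> D" "c < D" using c(1) K(1) by (auto simp: D_def)
  have haar: "branch_mean (haar_tree N x) (\<lambda>w. (norm (T (sum_list w)))\<^sup>2)
      \<le> D\<^sup>2 * real N powr (2 / p - 1) * branch_mean (haar_tree N x) (\<lambda>w. \<Sum>a\<leftarrow>w. (norm a)\<^sup>2)"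
    if "1 \<le> N" for N x
  proof -
    have "c * real N powr (1 / p - 1 / 2) < D * real N powr (1 / p - 1 / 2)"
      using D(3) that by (intro mult_strict_right_mono) auto
    with c(2)[OF that] have "haar_tau T N < D * real N powr (1 / p - 1 / 2)"
      by (rule le_less_trans)
    moreover have "(D * real N powr (1 / p - 1 / 2))\<^sup>2 = D\<^sup>2 * real N powr (2 / p - 1)"
      by (simp add: power_mult_distrib power2_eq_square powr_add[symmetric])
    ultimately show ?thesis
      using haar_tau_less_imp[OF assms(1)] by metis
  qed
  have "haar_tau_q p T n \<le> 300 * D * (1 + ln (real n))" if n: "1 \<le> n" for n
  proof -
    obtain M where M: "n \<le> 2 ^ M" "real M + 1 \<le> 2 * (1 + ln (real n))"
      using ex_dyadic_bound[OF n] by blast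
    define A where "A = (real M + 1) * (2 * D)"
    have A: "0 < A" using D(1) by (simp add: A_def)
    have "1 * D \<le> (real M + 1) * (2 * D)" using D(1) by (intro mult_mono) auto
    then have "K \<le> A" using D(2) by (simp add: A_def)
    then have opnorm: "norm (T a) \<le> A * norm a" for a
      using K(2)[of a] mult_left_mono[of K A "norm a"] by (simp add: mult.commute)
    have square: "branch_mean t (\<lambda>w. (norm (T (sum_list w)))\<^sup>2) \<le> (A * r)\<^sup>2"
      if "0 < r" "\<And>w. w \<in> branches t \<Longrightarrow> length w \<le> n"
        "\<And>w. w \<in> branches t \<Longrightarrow> (\<Sum>a\<leftarrow>w. norm a powr p) \<le> r powr p" for t r
    proof -
      have "branch_mean t (\<lambda>w. (norm (T (sum_list w)))\<^sup>2) \<le> (real M + 1)\<^sup>2 * (4 * D\<^sup>2 * r\<^sup>2)"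
        using that M(1) assms(2)
        by (intro bounded_tree_branch_mean_le[OF linear_axioms _ _ _ haar]) (auto intro: order_trans)
      also have "\<dots> = (A * r)\<^sup>2"
        unfolding A_def power_mult_distrib by simp
      finally show ?thesis .
    qed
    have "haar_tau_q p T n \<le> 75 * A"
    proof (rule haar_tau_q_le[OF linear_axioms])
      fix x
      let ?J = "branch_mean (haar_tree n x) (\<lambda>w. norm (T (sum_list w)) powr p)"
      let ?I = "branch_mean (haar_tree n x) (\<lambda>w. \<Sum>a\<leftarrow>w. norm a powr p)"
      have I: "0 \<le> ?I" by (intro branch_mean_nonneg sum_list_powr_nonneg)
      have J: "0 \<le> ?J" by (intro branch_mean_nonneg) simp
      have "?J \<le> 15 * (5 * A) powr p * ?I"
        by (rule branch_mean_powr_le[OF linear_axioms assms(2,3) A opnorm square])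
          (auto dest: length_branches_haar_tree)
      then have "?J powr (1 / p) \<le> (15 * (5 * A) powr p * ?I) powr (1 / p)"
        using J assms(2) by (intro powr_mono2) auto
      also have "\<dots> = 15 powr (1 / p) * (5 * A * ?I powr (1 / p))"
        using A I assms(2) by (simp add: powr_mult powr_powr)
      \<comment> \<open>As \<open>p \<ge> 1\<close>, the constant becomes \<open>15 * 5 = 75\<close>
        for every \<open>p\<close>; with \<open>A \<le> 4 * D * (1 + ln n)\<close> this yields
        \<open>300\<close>.\<close>
      also have "\<dots> \<le> 15 * (5 * A * ?I powr (1 / p))"
      proof (rule mult_right_mono)
        have "(15::real) powr (1 / p) \<le> 15 powr 1" using assms(2) by (intro powr_mono) auto
        then show "(15::real) powr (1 / p) \<le> 15" by simp
      qed (use A in simp)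
      finally show "?J powr (1 / p) \<le> 75 * A * ?I powr (1 / p)" by simp
    qed (use A assms(2) in auto)
    also have "75 * A \<le> 75 * (2 * (1 + ln (real n)) * (2 * D))"
      unfolding A_def using M(2) D(1) by (intro mult_left_mono mult_right_mono) auto
    finally show ?thesis by (simp add: mult_ac)
  qed
  then show ?thesis using D(1) by (intro exI[of _ "300 * D"]) auto
qed

end
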